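(* Let $(\Omega,\mathcal{F},P)$ be a complete and nonatomic probability space, let $\Xi$ be a separable metric space equipped with its Borel $\sigma$-algebra $\mathcal{B}(\Xi)$, let $\xi\colon\Omega\to\Xi$ be a random element, and let $p\in[1,+\infty)$ and $\varepsilon\ge 0$. Let $X$ be a separable metric space. Suppose that: (1) the map $F\colon X\times\Xi\to[0,+\infty)$ is random lower semicontinuous; (2) for every $x\in X$, the random variable $F_x(\xi):=F(x,\xi)$ belongs to $\mathcal{L}^{p+\varepsilon}(\Omega,\mathcal{F},P)$; (3) $\rho\colon\mathcal{L}^p(\Omega,\mathcal{F},P)\to\mathbb{R}$ is a convex, law invariant risk measure; (4) $(\Theta,\mathcal{A},\mathbb{P})$ is a probability space and, for each $\theta\in\Theta$, $(\nu_{N,\theta})_{N\in\mathbb{N}}$ is a sequence of probability measures on $(\Xi,\mathcal{B}(\Xi))$ such that for each random variable $Z\colon\Xi\to\mathbb{R}$ with $Z\circ\xi\in\mathcal{L}^{p+\varepsilon}(\Omega,\mathcal{F},P)$, $$\lim_{N\to\infty}\rho(\nu_{N,\theta}\circ Z^{-1})=\rho(Z(\xi))\quad\text{for }\mathbb{P}\text{-almost all }\theta\in\Theta .$$ Then, for $\mathbb{P}$-almost every $\theta\in\Theta$, the sequence of functions $$X\ni x\mapsto\rho(\nu_{N,\theta}\circ F_x^{-1}),\qquad N\in\mathbb{N},$$ epiconverges, as $N\to\infty$, to the function $$X\ni x\mapsto\rho(F_x(\xi)).$$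
   Context: **Nonatomic.** $(\Omega,\mathcal{F},P)$ is called nonatomic if there exists a random variable $U\colon\Omega\to(0,1)$ with $U\sim\mathrm{Uniform}(0,1)$. **Random variables on $\Xi$.** A random variable $Z\colon\Xi\to\mathbb{R}$ is a Borel measurable map. $F_x$ denotes the map $\xi\mapsto F(x,\xi)$ on $\Xi$. For a probability measure $\nu$ on $\Xi$, $\nu\circ Z^{-1}$ is the pushforward of $\nu$ under $Z$, a probability measure on $\mathbb{R}$. **Risk measures.** A functional $\rho\colon\mathcal{L}^p(\Omega,\mathcal{F},P)\to\mathbb{R}$ is law invariant if $\rho(Y)=\rho(Z)$ whenever $Y,Z\in\mathcal{L}^p(\Omega,\mathcal{F},P)$ have the same distribution. A risk measure $\rho$ is convex if it is a convex function, monotone ($V\ge W$ almost surely implies $\rho(V)\ge\rho(W)$), and translation equivariant ($\rho(V+a)=\rho(V)+a$ for all $a\in\mathbb{R}$). **Risk measures of distributions.** Since $(\Omega,\mathcal{F},P)$ is nonatomic, every probability distribution $Q$ on $\mathbb{R}$ is the distribution of some random variable on $\Omega$ (e.g. $H_Q(U)$, where $H_Q$ is the quantile function of $Q$). For $Q$ with finite $p$th moment, $\rho(Q)$ denotes the common value $\rho(Y)$ over all $Y\in\mathcal{L}^p(\Omega,\mathcal{F},P)$ with distribution $Q$. It is understood that $\nu_{N,\theta}\circ Z^{-1}$ has finite $p$th moment for every $N\in\mathbb{N}$, every $\theta\in\Theta$ and every random variable $Z\colon\Xi\to\mathbb{R}$ with $Z\circ\xi\in\mathcal{L}^{p+\varepsilon}(\Omega,\mathcal{F},P)$,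 so that all expressions $\rho(\nu_{N,\theta}\circ Z^{-1})$ are defined. **Random lower semicontinuity.** $G\colon X\times\Xi\to(-\infty,+\infty]$ is random lower semicontinuous if the epigraphical multifunction $\upsilon\mapsto E(\upsilon):=\{(x,t)\in X\times\mathbb{R}: t\ge G(x,\upsilon)\}$ is closed-valued and measurable (i.e. $\{\upsilon\in\Xi:E(\upsilon)\cap O\neq\emptyset\}\in\mathcal{B}(\Xi)$ for every open $O\subset X\times\mathbb{R}$). **Epiconvergence.** For $f,f_n\colon X\to(-\infty,+\infty]$, $(f_n)$ epiconverges to $f$ as $n\to\infty$ if (i) for all $x\in X$ and all sequences $x_n\to x$ in $X$, $\liminf_{n\to\infty}f_n(x_n)\ge f(x)$; and (ii) for each $x\in X$ there exists a sequence $x_n\to x$ in $X$ with $\limsup_{n\to\infty}f_n(x_n)\le f(x)$. *)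

theory Defs
  imports "HOL-Probability.Probability"
begin

definition nonatomic :: "'a measure \<Rightarrow> bool" where
  "nonatomic M \<longleftrightarrow>
     (\<exists>U \<in> borel_measurable M. (\<forall>\<omega> \<in> space M. U \<omega> \<in> {0<..<1}) \<and>
        distr M borel U = uniform_measure lborel {0<..<1::real})"

definition Lp :: "'a measure \<Rightarrow> real \<Rightarrow> ('a \<Rightarrow> real) set" where
  "Lp M p = {Y \<in> borel_measurable M. integrable M (\<lambda>\<omega>. \<bar>Y \<omega>\<bar> powr p)}"

definition finite_moment :: "real \<Rightarrow> real measure \<Rightarrow> bool" where
  "finite_moment p Q \<longleftrightarrow> integrable Q (\<lambda>z. \<bar>z\<bar> powr p)"

text \<open>A functional on \<open>Lp M p\<close> is represented by a total function on \<open>'a \<Rightarrow> real\<close>;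
  its values outside \<open>Lp M p\<close> are never constrained.\<close>

definition law_invariant :: "'a measure \<Rightarrow> real \<Rightarrow> (('a \<Rightarrow> real) \<Rightarrow> real) \<Rightarrow> bool" where
  "law_invariant M p \<rho> \<longleftrightarrow>
     (\<forall>Y \<in> Lp M p. \<forall>Z \<in> Lp M p. distr M borel Y = distr M borel Z \<longrightarrow> \<rho> Y = \<rho> Z)"

definition convex_risk_measure :: "'a measure \<Rightarrow> real \<Rightarrow> (('a \<Rightarrow> real) \<Rightarrow> real) \<Rightarrow> bool" where
  "convex_risk_measure M p \<rho> \<longleftrightarrow>
     (\<forall>V \<in> Lp M p. \<forall>W \<in> Lp M p. \<forall>t \<in> {0..1}.
        \<rho> (\<lambda>\<omega>. t * V \<omega> + (1 - t) * W \<omega>) \<le> t * \<rho> V + (1 - t) * \<rho> W) \<and>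
     (\<forall>V \<in> Lp M p. \<forall>W \<in> Lp M p. (AE \<omega> in M. V \<omega> \<ge> W \<omega>) \<longrightarrow> \<rho> V \<ge> \<rho> W) \<and>
     (\<forall>V \<in> Lp M p. \<forall>a. \<rho> (\<lambda>\<omega>. V \<omega> + a) = \<rho> V + a)"

text \<open>The induced functional on distributions is meaningful when \<open>\<rho>\<close> is law invariant, \<open>M\<close> is
  nonatomic and \<open>Q\<close> is a probability measure on the Borel sets of the reals with finite \<open>p\<close>th
  moment: then exactly one \<open>r\<close> satisfies the description.\<close>

definition risk_of_law ::
    "'a measure \<Rightarrow> real \<Rightarrow> (('a \<Rightarrow> real) \<Rightarrow> real) \<Rightarrow> real measure \<Rightarrow> real" where
  "risk_of_law M p \<rho> Q = (THE r. \<exists>Y \<in> Lp M p. distr M borel Y = Q \<and> r = \<rho> Y)"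

definition epi_multifunction :: "('x \<times> 'b \<Rightarrow> ereal) \<Rightarrow> 'b \<Rightarrow> ('x \<times> real) set" where
  "epi_multifunction G \<upsilon> = {(x, t). ereal t \<ge> G (x, \<upsilon>)}"

definition random_lsc ::
    "('x::topological_space \<times> 'b::topological_space \<Rightarrow> ereal) \<Rightarrow> bool" where
  "random_lsc G \<longleftrightarrow>
     (\<forall>z. G z \<noteq> -\<infinity>) \<and>
     (\<forall>\<upsilon>. closed (epi_multifunction G \<upsilon>)) \<and>
     (\<forall>S. open S \<longrightarrow> {\<upsilon>. epi_multifunction G \<upsilon> \<inter> S \<noteq> {}} \<in> sets borel)"

definition epiconverges ::
    "(nat \<Rightarrow> 'x::topological_space \<Rightarrow> ereal) \<Rightarrow> ('x \<Rightarrow> ereal) \<Rightarrow> bool" where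
  "epiconverges fs f \<longleftrightarrow>
     (\<forall>x xs. xs \<longlonglongrightarrow> x \<longrightarrow> liminf (\<lambda>n. fs n (xs n)) \<ge> f x) \<and>
     (\<forall>x. \<exists>xs. xs \<longlonglongrightarrow> x \<and> limsup (\<lambda>n. fs n (xs n)) \<le> f x)"

end

theory Submission
  imports Defs
begin

text \<open>For the lower bound, \<open>F (x, \<cdot>)\<close> is the pointwise limit of the infima of \<open>F (y, \<cdot>)\<close> over basic
  neighbourhoods of \<open>x\<close>. Only countably many infima occur, so outside one null set the assumed
  convergence holds for all of them. Monotonicity of \<open>\<rho>\<close> on laws bounds the value at any point of a
  neighbourhood below by the value of the infimum, and convexity and monotonicity of \<open>\<rho>\<close> imply
  enough continuity to let the neighbourhood shrink. For the upper bound, the graph of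
  \<open>x \<mapsto> \<rho> (F (x, \<xi>))\<close> is separable, and convergence on a countable dense part of it yields
  recovery sequences by a diagonal argument.\<close>

section \<open>The spaces \<open>Lp\<close>\<close>

lemma Lp_measurable: "Y \<in> Lp M p \<Longrightarrow> Y \<in> borel_measurable M"
  by (simp add: Lp_def)

lemma Lp_bound:
  assumes "0 \<le> p" "Y \<in> borel_measurable M" "Z \<in> Lp M p" "AE \<omega> in M. \<bar>Y \<omega>\<bar> \<le> \<bar>Z \<omega>\<bar>"
  shows "Y \<in> Lp M p"
proof -
  have "integrable M (\<lambda>\<omega>. \<bar>Y \<omega>\<bar> powr p)"
  proof (rule Bochner_Integration.integrable_bound)
    show "integrable M (\<lambda>\<omega>. \<bar>Z \<omega>\<bar> powr p)" using assms(3) by (simp add: Lp_def)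
    show "(\<lambda>\<omega>. \<bar>Y \<omega>\<bar> powr p) \<in> borel_measurable M" using assms(2) by measurable
    show "AE \<omega> in M. norm (\<bar>Y \<omega>\<bar> powr p) \<le> norm (\<bar>Z \<omega>\<bar> powr p)"
      using assms(4) by eventually_elim (use assms(1) in \<open>auto intro: powr_mono2\<close>)
  qed
  then show ?thesis using assms(2) by (simp add: Lp_def)
qed

lemma Lp_scale: "Y \<in> Lp M p \<Longrightarrow> (\<lambda>\<omega>. c * Y \<omega>) \<in> Lp M p"
  by (auto simp: Lp_def abs_mult powr_mult)

lemma Lp_add:
  assumes "0 \<le> p" "Y \<in> Lp M p" "Z \<in> Lp M p"
  shows "(\<lambda>\<omega>. Y \<omega> + Z \<omega>) \<in> Lp M p"
proof -
  have [measurable]: "Y \<in> borel_measurable M" "Z \<in> borel_measurable M"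
    using assms by (auto simp: Lp_def)
  \<comment> \<open>The bound is \<open>|Y + Z| \<le> 2 * max |Y| |Z|\<close>, and the
    \<open>p\<close>th power of the maximum is at most the sum of the two \<open>p\<close>th
    powers.\<close>
  have "integrable M (\<lambda>\<omega>. max \<bar>Y \<omega>\<bar> \<bar>Z \<omega>\<bar> powr p)"
  proof (rule Bochner_Integration.integrable_bound)
    show "integrable M (\<lambda>\<omega>. \<bar>Y \<omega>\<bar> powr p + \<bar>Z \<omega>\<bar> powr p)"
      using assms by (intro Bochner_Integration.integrable_add) (auto simp: Lp_def)
  qed (auto simp: max_def)
  then have m: "(\<lambda>\<omega>. max \<bar>Y \<omega>\<bar> \<bar>Z \<omega>\<bar>) \<in> Lp M p"
    by (simp add: Lp_def)
  show ?thesis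
    by (rule Lp_bound[OF assms(1) _ Lp_scale[OF m, of 2]]) auto
qed

text \<open>Constants are integrable for a probability measure, so \<open>1 + |Y| powr q\<close> is
  an integrable bound. This brings variables given with exponent \<open>p + \<epsilon>\<close> into
  the domain of \<open>\<rho>\<close>.\<close>

lemma Lp_antimono:
  assumes "prob_space M" "0 \<le> p" "p \<le> q"
  shows "Lp M q \<subseteq> Lp M p"
proof
  interpret prob_space M by fact
  fix Y assume Y: "Y \<in> Lp M q"
  then have [measurable]: "Y \<in> borel_measurable M" by (simp add: Lp_def)
  have "integrable M (\<lambda>\<omega>. \<bar>Y \<omega>\<bar> powr p)"
  proof (rule Bochner_Integration.integrable_bound)
    show "integrable M (\<lambda>\<omega>. 1 + \<bar>Y \<omega>\<bar> powr q)"
      using Y by (intro Bochner_Integration.integrable_add) (auto simp: Lp_def)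
    have "\<bar>Y \<omega>\<bar> powr p \<le> 1 + \<bar>Y \<omega>\<bar> powr q" for \<omega>
    proof (cases "\<bar>Y \<omega>\<bar> \<le> 1")
      case True
      then have "\<bar>Y \<omega>\<bar> powr p \<le> 1 powr p" using assms by (intro powr_mono2) auto
      then show ?thesis by (simp add: add_increasing2)
    next
      case False
      then have "\<bar>Y \<omega>\<bar> powr p \<le> \<bar>Y \<omega>\<bar> powr q" using assms by (intro powr_mono) auto
      then show ?thesis by simp
    qed
    then show "AE \<omega> in M. norm (\<bar>Y \<omega>\<bar> powr p) \<le> norm (1 + \<bar>Y \<omega>\<bar> powr q)"
      by (auto intro!: AE_I2 order_trans[OF _ abs_ge_self])
  qed measurable
  then show "Y \<in> Lp M p" by (simp add: Lp_def)
qed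

text \<open>Lets a moment condition on a law pass to any variable realising that law, in particular
  to a quantile function.\<close>

lemma Lp_distr_iff:
  assumes "Y \<in> borel_measurable M"
  shows "Y \<in> Lp M p \<longleftrightarrow> finite_moment p (distr M borel Y)"
  using assms by (simp add: Lp_def finite_moment_def integrable_distr_eq)

section \<open>The risk measure of a distribution\<close>

text \<open>\<open>Y\<close> itself witnesses the definite description in
  \<open>risk_of_law\<close>, and law invariance makes the described value unique.\<close>

lemma risk_of_law_distr:
  assumes "law_invariant M p \<rho>" "Y \<in> Lp M p"
  shows "risk_of_law M p \<rho> (distr M borel Y) = \<rho> Y"
  unfolding risk_of_law_def
proof (rule the_equality)
  show "\<exists>Z\<in>Lp M p. distr M borel Z = distr M borel Y \<and> \<rho> Y = \<rho> Z"
    using assms(2) by blast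
  show "r = \<rho> Y" if "\<exists>Z\<in>Lp M p. distr M borel Z = distr M borel Y \<and> r = \<rho> Z" for r
    using that assms unfolding law_invariant_def by blast
qed

text \<open>The generalised inverse of the cdf, \<open>I\<close> in the locale
  \<open>cdf_distribution\<close>, carries Lebesgue measure on the open unit interval to
  \<open>Q\<close>. Composing it with the uniform variable \<open>U\<close> realises
  \<open>Q\<close> on \<open>M\<close>.\<close>

lemma nonatomic_quantile_transform:
  assumes U: "U \<in> borel_measurable M" "\<And>\<omega>. \<omega> \<in> space M \<Longrightarrow> U \<omega> \<in> {0<..<1::real}"
    "distr M borel U = uniform_measure lborel {0<..<1}"
    and Q: "real_distribution Q"
  defines "H \<equiv> \<lambda>\<omega>. Inf {x. U \<omega> \<le> cdf Q x}"
  shows "H \<in> borel_measurable M" and "distr M borel H = Q"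
proof -
  interpret cdf_distribution Q using Q by (simp add: cdf_distribution_def)
  let ?R = "restrict_space borel {0<..<1::real}"
  have UR: "U \<in> M \<rightarrow>\<^sub>M ?R"
    using U by (intro measurable_restrict_space2) auto
  show HM: "H \<in> borel_measurable M"
    unfolding H_def using measurable_compose[OF UR measurable_CI] .
  \<comment> \<open>The properties of \<open>I\<close> are stated on the open unit interval, where
    the sets in its definition are nonempty and bounded below. The law of \<open>U\<close> is
    therefore moved there; the normalising factor is the length 1.\<close>
  have "distr M ?R U = restrict_space lborel {0<..<1::real}"
  proof (rule measure_eqI)
    fix A assume "A \<in> sets (distr M ?R U)"
    then have A: "A \<in> sets borel" "A \<subseteq> {0<..<1}"
      by (auto simp: sets_restrict_space)
    have AR: "A \<in> sets ?R" using A by (auto simp: sets_restrict_space)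
    have "emeasure (distr M ?R U) A = emeasure (distr M borel U) A"
      using A AR UR U(1) by (simp add: emeasure_distr)
    also have "\<dots> = emeasure (uniform_measure lborel {0<..<1}) A"
      by (simp add: U(3))
    also have "\<dots> = emeasure (restrict_space lborel {0<..<1::real}) A"
      using A by (simp add: emeasure_restrict_space Int_absorb1 divide_ennreal_def)
    finally show "emeasure (distr M ?R U) A = emeasure (restrict_space lborel {0<..<1::real}) A" .
  qed (simp add: sets_restrict_space)
  then have "distr (distr M ?R U) borel I = Q"
    using distr_I_eq_M by simp
  then show "distr M borel H = Q"
    using UR by (simp add: distr_distr[OF measurable_CI] H_def comp_def)
qed

text \<open>Comonotone coupling: both laws are realised on \<open>M\<close> as quantile functions of the same
  uniform variable, where the pointwise order is preserved.\<close>

lemma risk_of_law_mono: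
  assumes M: "nonatomic M" and \<rho>: "convex_risk_measure M p \<rho>" "law_invariant M p \<rho>"
    and N: "prob_space N" "A \<in> borel_measurable N" "B \<in> borel_measurable N"
    and le: "\<And>u. u \<in> space N \<Longrightarrow> A u \<le> B u"
    and fin: "finite_moment p (distr N borel A)" "finite_moment p (distr N borel B)"
  shows "risk_of_law M p \<rho> (distr N borel A) \<le> risk_of_law M p \<rho> (distr N borel B)"
proof -
  interpret N: prob_space N by fact
  obtain U where U: "U \<in> borel_measurable M" "\<And>\<omega>. \<omega> \<in> space M \<Longrightarrow> U \<omega> \<in> {0<..<1::real}"
    "distr M borel U = uniform_measure lborel {0<..<1}"
    using M by (auto simp: nonatomic_def)
  have distA: "real_distribution (distr N borel A)" and distB: "real_distribution (distr N borel B)"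
    using N by (auto intro: N.real_distribution_distr)
  interpret A: cdf_distribution "distr N borel A" using distA by (simp add: cdf_distribution_def)
  interpret B: cdf_distribution "distr N borel B" using distB by (simp add: cdf_distribution_def)
  define HA where "HA \<omega> = Inf {x. U \<omega> \<le> cdf (distr N borel A) x}" for \<omega>
  define HB where "HB \<omega> = Inf {x. U \<omega> \<le> cdf (distr N borel B) x}" for \<omega>
  note HA = nonatomic_quantile_transform[OF U distA, folded HA_def]
  note HB = nonatomic_quantile_transform[OF U distB, folded HB_def]
  have LA: "HA \<in> Lp M p" and LB: "HB \<in> Lp M p"
    using fin HA HB by (simp_all add: Lp_distr_iff)
  have cdf_le: "cdf (distr N borel B) x \<le> cdf (distr N borel A) x" for x
    unfolding cdf_def using N le
    by (auto simp: measure_distr intro!: N.finite_measure_mono intro: order_trans)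
  have "HA \<omega> \<le> HB \<omega>" if "\<omega> \<in> space M" for \<omega>
  proof -
    have u: "0 < U \<omega>" "U \<omega> < 1" using U(2)[OF that] by auto
    \<comment> \<open>\<open>pseudoinverse\<close> is the Galois connection between cdf and quantile
      function. It is used at the point \<open>HB \<omega>\<close>, forwards for the law of
      \<open>B\<close> and then backwards for the law of \<open>A\<close>.\<close>
    have "U \<omega> \<le> cdf (distr N borel B) (HB \<omega>)"
      using B.pseudoinverse[OF u, of "HB \<omega>"] by (simp add: HB_def)
    also note cdf_le
    finally show ?thesis
      using A.pseudoinverse[OF u, of "HB \<omega>"] by (simp add: HA_def)
  qed
  then have "\<rho> HA \<le> \<rho> HB"
    using \<rho>(1) LA LB by (auto simp: convex_risk_measure_def)
  then show ?thesis
    using risk_of_law_distr[OF \<rho>(2) LA] risk_of_law_distr[OF \<rho>(2) LB] HA HB by simp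
qed

section \<open>Continuity of convex risk measures under domination\<close>

text \<open>By monotone convergence the series of functions has finite integral, so it is finite
  almost everywhere.\<close>

lemma AE_summable_of_summable_integral:
  fixes f :: "nat \<Rightarrow> 'a \<Rightarrow> real"
  assumes f: "\<And>j. integrable M (f j)" "\<And>j \<omega>. 0 \<le> f j \<omega>"
    and s: "summable (\<lambda>j. \<integral>\<omega>. f j \<omega> \<partial>M)"
  shows "AE \<omega> in M. summable (\<lambda>j. f j \<omega>)"
proof -
  have [measurable]: "f j \<in> borel_measurable M" for j using f(1) by auto
  have "(\<integral>\<^sup>+\<omega>. (\<Sum>j. ennreal (f j \<omega>)) \<partial>M) = (\<Sum>j. \<integral>\<^sup>+\<omega>. ennreal (f j \<omega>) \<partial>M)"
    by (rule nn_integral_suminf) measurable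
  also have "\<dots> = (\<Sum>j. ennreal (\<integral>\<omega>. f j \<omega> \<partial>M))"
    using f by (intro suminf_cong nn_integral_eq_integral) auto
  also have "\<dots> = ennreal (\<Sum>j. \<integral>\<omega>. f j \<omega> \<partial>M)"
    using s f(2) by (intro suminf_ennreal2) (auto intro!: integral_nonneg_AE)
  also have "\<dots> < \<infinity>" by simp
  finally have "AE \<omega> in M. (\<Sum>j. ennreal (f j \<omega>)) \<noteq> \<infinity>"
    by (intro nn_integral_PInf_AE) (auto simp: less_top)
  then show ?thesis
    by eventually_elim (auto intro!: summable_suminf_not_top f(2))
qed

text \<open>The subsequence is so sparse that the \<open>p\<close>th moments of \<open>(j + 1) D (r j)\<close> are summable;
  \<open>W\<close> is then the pointwise \<open>\<ell>\<^sup>p\<close> norm over \<open>j\<close> of these functions.\<close>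

lemma Lp_null_sequence_order_bound:
  fixes D :: "nat \<Rightarrow> 'a \<Rightarrow> real"
  assumes p: "1 \<le> p" and D [measurable]: "\<And>k. D k \<in> borel_measurable M"
    and G: "G \<in> Lp M p" and dom: "\<And>k \<omega>. \<bar>D k \<omega>\<bar> \<le> \<bar>G \<omega>\<bar>"
    and lim: "\<And>\<omega>. (\<lambda>k. D k \<omega>) \<longlonglongrightarrow> 0"
  obtains W and r :: "nat \<Rightarrow> nat" where "W \<in> Lp M p"
    "\<And>j. AE \<omega> in M. \<bar>D (r j) \<omega>\<bar> \<le> W \<omega> / real (Suc j)"
proof -
  have [measurable]: "G \<in> borel_measurable M" using G by (simp add: Lp_def)
  have DLp: "D k \<in> Lp M p" for k
    by (rule Lp_bound[OF _ D G]) (use p dom in auto)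
  have small: "\<exists>k. (\<integral>\<omega>. \<bar>real (Suc j) * D k \<omega>\<bar> powr p \<partial>M) < (1/2) ^ j" for j
  proof -
    \<comment> \<open>For fixed \<open>j\<close> the factor \<open>j + 1\<close> is a constant, so
      dominated convergence applies with a bound built from \<open>G\<close>.\<close>
    have "(\<lambda>k. \<integral>\<omega>. \<bar>real (Suc j) * D k \<omega>\<bar> powr p \<partial>M) \<longlonglongrightarrow> (\<integral>\<omega>. 0 \<partial>M)"
    proof (rule integral_dominated_convergence)
      show "integrable M (\<lambda>\<omega>. \<bar>real (Suc j) * G \<omega>\<bar> powr p)"
        using Lp_scale[OF G, of "real (Suc j)"] by (simp add: Lp_def)
      show "AE \<omega> in M. (\<lambda>k. \<bar>real (Suc j) * D k \<omega>\<bar> powr p) \<longlonglongrightarrow> 0"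
      proof (rule AE_I2)
        fix \<omega>
        have "(\<lambda>k. real (Suc j) * D k \<omega>) \<longlonglongrightarrow> 0"
          by (rule tendsto_mult_right_zero[OF lim])
        then have "(\<lambda>k. \<bar>real (Suc j) * D k \<omega>\<bar>) \<longlonglongrightarrow> 0"
          by (rule tendsto_rabs_zero)
        then show "(\<lambda>k. \<bar>real (Suc j) * D k \<omega>\<bar> powr p) \<longlonglongrightarrow> 0"
          using p by (intro tendsto_zero_powrI[where b = p]) auto
      qed
      show "AE \<omega> in M. norm (\<bar>real (Suc j) * D k \<omega>\<bar> powr p) \<le> \<bar>real (Suc j) * G \<omega>\<bar> powr p" for k
        using p dom by (auto intro!: AE_I2 powr_mono2 mult_left_mono simp: abs_mult)
    qed measurable
    then have "(\<lambda>k. \<integral>\<omega>. \<bar>real (Suc j) * D k \<omega>\<bar> powr p \<partial>M) \<longlonglongrightarrow> 0" by simp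
    then have "eventually (\<lambda>k. (\<integral>\<omega>. \<bar>real (Suc j) * D k \<omega>\<bar> powr p \<partial>M) < (1/2) ^ j) sequentially"
      by (rule order_tendstoD) simp
    then show ?thesis by (rule eventually_happens'[OF sequentially_bot])
  qed
  then obtain r where r: "\<And>j. (\<integral>\<omega>. \<bar>real (Suc j) * D (r j) \<omega>\<bar> powr p \<partial>M) < (1/2) ^ j"
    by metis
  define f where "f j \<omega> = \<bar>real (Suc j) * D (r j) \<omega>\<bar> powr p" for j \<omega>
  define W where "W \<omega> = (\<Sum>j. f j \<omega>) powr (1 / p)" for \<omega>
  have f0: "0 \<le> f j \<omega>" for j \<omega> by (simp add: f_def)
  have int: "integrable M (f j)" for j
    using Lp_scale[OF DLp, of "real (Suc j)" "r j"] by (simp add: Lp_def f_def[abs_def])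
  have sumI: "summable (\<lambda>j. \<integral>\<omega>. f j \<omega> \<partial>M)"
  proof (rule summable_comparison_test')
    show "summable (\<lambda>j. (1/2::real) ^ j)" by simp
    show "norm (\<integral>\<omega>. f j \<omega> \<partial>M) \<le> (1/2) ^ j" for j
      using r[of j] f0 by (simp add: f_def less_imp_le)
  qed
  have AEs: "AE \<omega> in M. summable (\<lambda>j. f j \<omega>)"
    by (rule AE_summable_of_summable_integral[OF int f0 sumI])
  have "integrable M (\<lambda>\<omega>. \<Sum>j. f j \<omega>)"
    using AEs sumI f0 by (intro integrable_suminf int) auto
  then have "integrable M (\<lambda>\<omega>. W \<omega> powr p)"
  proof (rule integrable_cong_AE_imp)
    show "(\<lambda>\<omega>. W \<omega> powr p) \<in> borel_measurable M"
      unfolding W_def f_def by measurable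
    show "AE \<omega> in M. (\<Sum>j. f j \<omega>) = W \<omega> powr p"
      using AEs by eventually_elim (use p f0 in \<open>simp add: W_def powr_powr suminf_nonneg\<close>)
  qed
  \<comment> \<open>\<open>powr\<close> is nonnegative for every base, so this includes the null set
    where the series diverges and its sum is unspecified.\<close>
  moreover have "0 \<le> W \<omega>" for \<omega> by (simp add: W_def)
  moreover have "W \<in> borel_measurable M"
    unfolding W_def f_def by measurable
  ultimately have "W \<in> Lp M p" by (simp add: Lp_def)
  moreover have "AE \<omega> in M. \<bar>D (r j) \<omega>\<bar> \<le> W \<omega> / real (Suc j)" for j
    using AEs
  proof eventually_elim
    case (elim \<omega>)
    have "f j \<omega> \<le> (\<Sum>j. f j \<omega>)"
      using sum_le_suminf[OF elim, of "{j}"] f0 by simp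
    then have "f j \<omega> powr (1 / p) \<le> W \<omega>"
      unfolding W_def using p f0 by (intro powr_mono2) auto
    moreover have "f j \<omega> powr (1 / p) = real (Suc j) * \<bar>D (r j) \<omega>\<bar>"
      using p by (simp add: f_def powr_powr abs_mult)
    ultimately show ?case by (simp add: pos_le_divide_eq mult.commute)
  qed
  ultimately show ?thesis by (rule that)
qed

text \<open>With \<open>s = 1 / (j + 1)\<close> and \<open>W\<close> from the preceding lemma, convexity is applied to
  \<open>V = (V - s W) / (1 + s) + (s / (1 + s)) (V + W)\<close>, and \<open>V - s W\<close> lies below a member of the
  sequence.\<close>

lemma convex_risk_measure_lower_limit:
  fixes Vs :: "nat \<Rightarrow> 'a \<Rightarrow> real"
  assumes p: "1 \<le> p" and \<rho>: "convex_risk_measure M p \<rho>"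
    and Vs [measurable]: "\<And>k. Vs k \<in> borel_measurable M"
    and G: "G \<in> Lp M p" and dom: "\<And>k \<omega>. \<bar>Vs k \<omega>\<bar> \<le> \<bar>G \<omega>\<bar>"
    and V: "V \<in> Lp M p" and lim: "\<And>\<omega>. (\<lambda>k. Vs k \<omega>) \<longlonglongrightarrow> V \<omega>"
    and c: "c < \<rho> V"
  obtains k where "c < \<rho> (Vs k)"
proof -
  have p0: "0 \<le> p" using p by simp
  have [measurable]: "V \<in> borel_measurable M" using V by (simp add: Lp_def)
  have VsLp: "Vs k \<in> Lp M p" for k
    by (rule Lp_bound[OF p0 Vs G]) (use dom in auto)
  \<comment> \<open>The domination passes to the limit, so the differences \<open>V - Vs k\<close>
    are bounded by \<open>2 * G\<close> in absolute value.\<close>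
  have domV: "\<bar>V \<omega>\<bar> \<le> \<bar>G \<omega>\<bar>" for \<omega>
    using tendsto_rabs[OF lim] by (rule LIMSEQ_le_const2) (use dom in auto)
  obtain W r where W: "W \<in> Lp M p"
    and r: "\<And>j. AE \<omega> in M. \<bar>V \<omega> - Vs (r j) \<omega>\<bar> \<le> W \<omega> / real (Suc j)"
  proof (rule Lp_null_sequence_order_bound[OF p, where D = "\<lambda>k \<omega>. V \<omega> - Vs k \<omega>" and M = M])
    show "(\<lambda>\<omega>. 2 * G \<omega>) \<in> Lp M p" by (rule Lp_scale[OF G])
    show "\<bar>V \<omega> - Vs k \<omega>\<bar> \<le> \<bar>2 * G \<omega>\<bar>" for k \<omega>
      using domV[of \<omega>] dom[of k \<omega>] by linarith
    show "(\<lambda>k. V \<omega> - Vs k \<omega>) \<longlonglongrightarrow> 0" for \<omega>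
      using tendsto_diff[OF tendsto_const lim, of "V \<omega>" \<omega>] by simp
  qed (auto)
  have VW: "(\<lambda>\<omega>. V \<omega> + W \<omega>) \<in> Lp M p" by (rule Lp_add[OF p0 V W])
  have lower: "(1 + s) * \<rho> V - s * \<rho> (\<lambda>\<omega>. V \<omega> + W \<omega>) \<le> \<rho> (Vs (r j))"
    if s: "s = 1 / real (Suc j)" for s j
  proof -
    have s0: "0 < s" using s by simp
    have VsW: "(\<lambda>\<omega>. V \<omega> + (- s) * W \<omega>) \<in> Lp M p"
      by (rule Lp_add[OF p0 V Lp_scale[OF W]])
    define t where "t = 1 / (1 + s)"
    have t: "t \<in> {0..1}" "t * (1 + s) = 1" "1 - t = t * s"
      using s0 by (auto simp: t_def field_simps)
    have conv: "\<forall>A\<in>Lp M p. \<forall>B\<in>Lp M p. \<forall>t\<in>{0..1}.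
        \<rho> (\<lambda>\<omega>. t * A \<omega> + (1 - t) * B \<omega>) \<le> t * \<rho> A + (1 - t) * \<rho> B"
      and mono: "\<forall>A\<in>Lp M p. \<forall>B\<in>Lp M p. (AE \<omega> in M. B \<omega> \<le> A \<omega>) \<longrightarrow> \<rho> B \<le> \<rho> A"
      using \<rho> by (simp_all add: convex_risk_measure_def)
    have "V \<omega> = t * (V \<omega> + (- s) * W \<omega>) + (1 - t) * (V \<omega> + W \<omega>)" for \<omega>
    proof -
      have "t * (V \<omega> + (- s) * W \<omega>) + (1 - t) * (V \<omega> + W \<omega>) = t * (1 + s) * V \<omega>"
        unfolding t(3) by (simp add: algebra_simps)
      then show ?thesis using t(2) by simp
    qed
    then have "\<rho> V = \<rho> (\<lambda>\<omega>. t * (V \<omega> + (- s) * W \<omega>) + (1 - t) * (V \<omega> + W \<omega>))"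
      by presburger
    also have "\<dots> \<le> t * \<rho> (\<lambda>\<omega>. V \<omega> + (- s) * W \<omega>) + (1 - t) * \<rho> (\<lambda>\<omega>. V \<omega> + W \<omega>)"
      by (rule conv[rule_format, OF VsW VW t(1)])
    also have "\<dots> = (\<rho> (\<lambda>\<omega>. V \<omega> + (- s) * W \<omega>) + s * \<rho> (\<lambda>\<omega>. V \<omega> + W \<omega>)) / (1 + s)"
      unfolding t(3) by (simp add: t_def add_divide_distrib)
    finally have "(1 + s) * \<rho> V \<le> \<rho> (\<lambda>\<omega>. V \<omega> + (- s) * W \<omega>) + s * \<rho> (\<lambda>\<omega>. V \<omega> + W \<omega>)"
      using s0 by (simp add: pos_le_divide_eq mult.commute)
    moreover have "AE \<omega> in M. V \<omega> + (- s) * W \<omega> \<le> Vs (r j) \<omega>"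
      using r[of j] by eventually_elim (auto simp: s abs_le_iff)
    then have "\<rho> (\<lambda>\<omega>. V \<omega> + (- s) * W \<omega>) \<le> \<rho> (Vs (r j))"
      by (rule mono[rule_format, OF VsLp VsW])
    ultimately show ?thesis by linarith
  qed
  \<comment> \<open>\<open>W\<close> does not depend on \<open>j\<close>, so the weight of the fixed
    number \<open>\<rho> (V + W)\<close> vanishes and the lower bound tends to
    \<open>\<rho> V\<close>, which exceeds \<open>c\<close>.\<close>
  have "(\<lambda>j. (1 + 1 / real (Suc j)) * \<rho> V - (1 / real (Suc j)) * \<rho> (\<lambda>\<omega>. V \<omega> + W \<omega>))
      \<longlonglongrightarrow> (1 + 0) * \<rho> V - 0 * \<rho> (\<lambda>\<omega>. V \<omega> + W \<omega>)"
    using LIMSEQ_inverse_real_of_nat by (intro tendsto_intros) (simp_all add: inverse_eq_divide)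
  then have "eventually (\<lambda>j. c < (1 + 1 / real (Suc j)) * \<rho> V
      - (1 / real (Suc j)) * \<rho> (\<lambda>\<omega>. V \<omega> + W \<omega>)) sequentially"
    using c by (intro order_tendstoD) auto
  then obtain j where "c < (1 + 1 / real (Suc j)) * \<rho> V
      - (1 / real (Suc j)) * \<rho> (\<lambda>\<omega>. V \<omega> + W \<omega>)"
    using eventually_happens'[OF sequentially_bot] by blast
  then show ?thesis using lower[OF refl, of j] by (intro that[of "r j"]) linarith
qed

section \<open>Infima of a random lower semicontinuous integrand\<close>

text \<open>The infimum over \<open>S\<close> is below \<open>a\<close> exactly when the epigraph
  meets the open set \<open>S \<times> {..<a}\<close>, and random lower semicontinuity makes this
  event Borel.\<close>

lemma random_lsc_INF_measurable:
  fixes F :: "'x::topological_space \<times> 'b::topological_space \<Rightarrow> real"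
  assumes F: "random_lsc (\<lambda>z. ereal (F z))" "\<And>z. 0 \<le> F z" and S: "open S" "S \<noteq> {}"
  shows "(\<lambda>u. INF x\<in>S. F (x, u)) \<in> borel_measurable borel"
  unfolding borel_measurable_iff_less
proof
  fix a :: real
  have bdd: "bdd_below ((\<lambda>x. F (x, u)) ` S)" for u
    using F(2) by (auto intro!: bdd_belowI[of _ 0])
  have "{u \<in> space borel. (INF x\<in>S. F (x, u)) < a} =
      {u. epi_multifunction (\<lambda>z. ereal (F z)) u \<inter> (S \<times> {..<a}) \<noteq> {}}"
    using S(2) by (auto simp: cINF_less_iff bdd epi_multifunction_def dest: le_less_trans)
  also have "\<dots> \<in> sets borel"
    using F(1) open_Times[OF S(1) open_lessThan, of a] unfolding random_lsc_def by blast
  finally show "{u \<in> space borel. (INF x\<in>S. F (x, u)) < a} \<in> sets borel" .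
qed

text \<open>The point \<open>(x, a)\<close> lies outside the closed epigraph, so a whole product
  neighbourhood of it does; its first factor serves as \<open>S\<close>.\<close>

lemma random_lsc_eventually_greater:
  fixes F :: "'x::topological_space \<times> 'b::topological_space \<Rightarrow> real"
  assumes F: "random_lsc (\<lambda>z. ereal (F z))" and a: "a < F (x, u)"
  obtains S where "open S" "x \<in> S" "\<And>y. y \<in> S \<Longrightarrow> a < F (y, u)"
proof -
  have "open (- epi_multifunction (\<lambda>z. ereal (F z)) u)"
    using F by (auto simp: random_lsc_def)
  moreover have "(x, a) \<in> - epi_multifunction (\<lambda>z. ereal (F z)) u"
    using a by (simp add: epi_multifunction_def)
  ultimately obtain A B where AB: "open A" "open B" "(x, a) \<in> A \<times> B"
    "A \<times> B \<subseteq> - epi_multifunction (\<lambda>z. ereal (F z)) u"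
    by (rule open_prod_elim)
  show ?thesis
  proof (rule that[of A])
    show "a < F (y, u)" if "y \<in> A" for y
    proof -
      have "(y, a) \<in> A \<times> B" using that AB(3) by simp
      with AB(4) show ?thesis by (auto simp: epi_multifunction_def)
    qed
  qed (use AB in auto)
qed

text \<open>Since \<open>x\<close> belongs to every \<open>S k\<close>, no infimum exceeds the value
  at \<open>x\<close>; lower semicontinuity at \<open>x\<close> gives the matching bound from
  below.\<close>

lemma random_lsc_INF_tendsto:
  fixes F :: "'x::topological_space \<times> 'b::topological_space \<Rightarrow> real"
  assumes F: "random_lsc (\<lambda>z. ereal (F z))" "\<And>z. 0 \<le> F z"
    and S: "\<And>k. x \<in> S k" "\<And>T. open T \<Longrightarrow> x \<in> T \<Longrightarrow> eventually (\<lambda>k. S k \<subseteq> T) sequentially"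
  shows "(\<lambda>k. INF y\<in>S k. F (y, u)) \<longlonglongrightarrow> F (x, u)"
proof (rule order_tendstoI)
  have bdd: "bdd_below ((\<lambda>x. F (x, u)) ` A)" for A
    using F(2) by (auto intro!: bdd_belowI[of _ 0])
  fix a
  show "eventually (\<lambda>k. (INF y\<in>S k. F (y, u)) < a) sequentially" if "F (x, u) < a"
    using S(1) that by (auto intro!: always_eventually le_less_trans[OF cINF_lower[OF bdd]])
  assume "a < F (x, u)"
  \<comment> \<open>A strict bound on all values yields only a weak bound on their infimum, so room
    is left between \<open>a\<close> and \<open>b\<close>.\<close>
  then obtain b where b: "a < b" "b < F (x, u)" using dense by blast
  obtain T where T: "open T" "x \<in> T" "\<And>y. y \<in> T \<Longrightarrow> b < F (y, u)"
    using random_lsc_eventually_greater[OF F(1) b(2)] by blast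
  show "eventually (\<lambda>k. a < (INF y\<in>S k. F (y, u))) sequentially"
    using S(2)[OF T(1,2)]
  proof eventually_elim
    case (elim k)
    have "b \<le> (INF y\<in>S k. F (y, u))"
      using S(1)[of k] elim T(3) by (intro cINF_greatest) (auto intro: less_imp_le)
    with b(1) show ?case by simp
  qed
qed

section \<open>Recovery sequences\<close>

text \<open>A dense set of arguments would not control the values of a discontinuous
  \<open>f\<close>. A dense subset of the graph approximates argument and value together.\<close>

lemma countable_graph_dense:
  fixes f :: "'x::{metric_space, second_countable_topology} \<Rightarrow> real"
  obtains C where "countable C"
    "\<And>x e. 0 < e \<Longrightarrow> \<exists>d\<in>C. dist d x < e \<and> f d < f x + e"
proof -
  let ?G = "range (\<lambda>x. (x, f x))"
  obtain K where K: "countable K" "K \<subseteq> ?G" "?G \<subseteq> closure K"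
    by (rule separable)
  show ?thesis
  proof (rule that[of "fst ` K"])
    show "countable (fst ` K)" using K(1) by simp
    fix x :: 'x and e :: real assume e: "0 < e"
    have "(x, f x) \<in> closure K" using K(3) by auto
    then obtain z where z: "z \<in> K" "dist z (x, f x) < e"
      using e by (auto simp: closure_approachable)
    then obtain d where d: "z = (d, f d)" using K(2) by auto
    have "dist d x < e" "dist (f d) (f x) < e"
      using le_less_trans[OF dist_fst_le z(2)] le_less_trans[OF dist_snd_le z(2)] d by auto
    then have "dist d x < e \<and> f d < f x + e" by (auto simp: dist_real_def)
    moreover have "d \<in> fst ` K" using z(1) d by force
    ultimately show "\<exists>d\<in>fst ` K. dist d x < e \<and> f d < f x + e" by blast
  qed
qed

text \<open>At time \<open>n\<close> the sequence uses the approximant \<open>d m\<close> with the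
  largest \<open>m \<le> n\<close> whose value under \<open>g n\<close> is already below
  \<open>f x + e m\<close>. Every \<open>m\<close> qualifies eventually, so the chosen index tends
  to infinity.\<close>

lemma diagonal_recovery_sequence:
  fixes g :: "nat \<Rightarrow> 'x::metric_space \<Rightarrow> real" and f :: "'x \<Rightarrow> real"
  assumes C: "\<And>e. 0 < e \<Longrightarrow> \<exists>d\<in>C. dist d x < e \<and> f d < f x + e"
    and lim: "\<And>d. d \<in> C \<Longrightarrow> (\<lambda>n. g n d) \<longlonglongrightarrow> f d"
  obtains xs where "xs \<longlonglongrightarrow> x" "limsup (\<lambda>n. ereal (g n (xs n))) \<le> ereal (f x)"
proof -
  define e where "e m = 1 / real (Suc m)" for m
  have e: "0 < e m" for m by (simp add: e_def)
  have e_lim: "e \<longlonglongrightarrow> 0"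
    unfolding e_def using LIMSEQ_inverse_real_of_nat by (simp add: inverse_eq_divide)
  have "\<forall>m. \<exists>d. d \<in> C \<and> dist d x < e m \<and> f d < f x + e m"
    using C[OF e] by blast
  then obtain d where d: "\<And>m. d m \<in> C" "\<And>m. dist (d m) x < e m" "\<And>m. f (d m) < f x + e m"
    by metis
  \<comment> \<open>The bound \<open>m \<le> n\<close> makes the set finite, and admitting 0
    unconditionally makes it nonempty, so that \<open>Max\<close> is meaningful.\<close>
  define A where "A n = {m. m \<le> n \<and> (m = 0 \<or> g n (d m) < f x + e m)}" for n
  define h where "h n = Max (A n)" for n
  have A: "finite (A n)" "0 \<in> A n" for n by (auto simp: A_def)
  have hA: "h n \<in> A n" for n unfolding h_def using A[of n] by (intro Max_in) auto
  have h_ge: "eventually (\<lambda>n. m \<le> h n) sequentially" for m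
  proof -
    have "eventually (\<lambda>n. g n (d m) < f x + e m) sequentially"
      using lim[OF d(1)] d(3) by (rule order_tendstoD)
    then show ?thesis using eventually_ge_at_top[of m]
      by eventually_elim (auto simp: h_def A A_def intro!: Max_ge)
  qed
  have "filterlim h at_top sequentially"
    using h_ge by (simp add: filterlim_at_top)
  then have eh: "(\<lambda>n. e (h n)) \<longlonglongrightarrow> 0"
    by (rule filterlim_compose[OF e_lim])
  show ?thesis
  proof (rule that[of "\<lambda>n. d (h n)"])
    show "(\<lambda>n. d (h n)) \<longlonglongrightarrow> x"
    proof (subst tendsto_dist_iff, rule tendsto_sandwich[OF _ _ tendsto_const eh])
      show "eventually (\<lambda>n. dist (d (h n)) x \<le> e (h n)) sequentially"
        using d(2) by (intro always_eventually allI less_imp_le)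
    qed simp
    have "limsup (\<lambda>n. ereal (g n (d (h n)))) \<le> limsup (\<lambda>n. ereal (f x + e (h n)))"
    proof (rule Limsup_mono)
      show "eventually (\<lambda>n. ereal (g n (d (h n))) \<le> ereal (f x + e (h n))) sequentially"
        \<comment> \<open>The index 0 carries no estimate, so the inequality is claimed only once
          \<open>h n\<close> is positive.\<close>
        using h_ge[of 1]
      proof eventually_elim
        case (elim n)
        then show ?case using hA[of n] by (simp add: A_def)
      qed
    qed
    also have "\<dots> = ereal (f x)"
      using tendsto_add[OF tendsto_const eh, of "f x"] by (intro lim_imp_Limsup) auto
    finally show "limsup (\<lambda>n. ereal (g n (d (h n)))) \<le> ereal (f x)" .
  qed
qed

section \<open>Epiconvergence outside one null set\<close>

theorem theorem2:
  fixes M :: "'a measure"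
    and \<xi> :: "'a \<Rightarrow> 'b::{metric_space, second_countable_topology}"
    and F :: "'x::{metric_space, second_countable_topology} \<times> 'b \<Rightarrow> real"
    and \<rho> :: "('a \<Rightarrow> real) \<Rightarrow> real"
    and T :: "'t measure"
    and \<nu> :: "nat \<Rightarrow> 't \<Rightarrow> 'b measure"
    and p \<epsilon> :: real
  assumes "prob_space M" and "complete_measure M" and "nonatomic M"
    and "\<xi> \<in> borel_measurable M"
    and "1 \<le> p" and "0 \<le> \<epsilon>"
    and "\<And>z. 0 \<le> F z"
    and "random_lsc (\<lambda>z. ereal (F z))"
    and "\<And>x. (\<lambda>\<omega>. F (x, \<xi> \<omega>)) \<in> Lp M (p + \<epsilon>)"
    and "convex_risk_measure M p \<rho>" and "law_invariant M p \<rho>"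
    and "prob_space T"
    and "\<And>N \<theta>. \<theta> \<in> space T \<Longrightarrow> prob_space (\<nu> N \<theta>)"
    and "\<And>N \<theta>. \<theta> \<in> space T \<Longrightarrow> sets (\<nu> N \<theta>) = sets borel"
    and "\<And>N \<theta> Z. \<theta> \<in> space T \<Longrightarrow> Z \<in> borel_measurable borel \<Longrightarrow>
           (\<lambda>\<omega>. Z (\<xi> \<omega>)) \<in> Lp M (p + \<epsilon>) \<Longrightarrow> finite_moment p (distr (\<nu> N \<theta>) borel Z)"
    and "\<And>Z. Z \<in> borel_measurable borel \<Longrightarrow> (\<lambda>\<omega>. Z (\<xi> \<omega>)) \<in> Lp M (p + \<epsilon>) \<Longrightarrow>
           (AE \<theta> in T. (\<lambda>N. risk_of_law M p \<rho> (distr (\<nu> N \<theta>) borel Z))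
                          \<longlonglongrightarrow> \<rho> (\<lambda>\<omega>. Z (\<xi> \<omega>)))"
  shows "AE \<theta> in T. epiconverges
           (\<lambda>N x. ereal (risk_of_law M p \<rho> (distr (\<nu> N \<theta>) borel (\<lambda>u. F (x, u)))))
           (\<lambda>x. ereal (\<rho> (\<lambda>\<omega>. F (x, \<xi> \<omega>))))"
proof -
  interpret M: prob_space M by fact
  have p0: "0 \<le> p" and pe0: "0 \<le> p + \<epsilon>" using assms(5,6) by auto
  have sub: "Lp M (p + \<epsilon>) \<subseteq> Lp M p"
    using assms(1,5,6) by (intro Lp_antimono) auto
  note [measurable] = assms(4)
  obtain B :: "'x set set" where B: "countable B" "topological_basis B"
    using ex_countable_basis by auto
  define Z where "Z S u = (INF x\<in>S. F (x, u))" for S :: "'x set" and u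
  have bdd: "bdd_below ((\<lambda>x. F (x, u)) ` S)" for S u
    using assms(7) by (auto intro!: bdd_belowI[of _ 0])
  have Z_le: "Z S u \<le> F (x, u)" if "x \<in> S" for S x u
    unfolding Z_def by (rule cINF_lower[OF bdd that])
  have Z_nonneg: "0 \<le> Z S u" if "S \<noteq> {}" for S u
    unfolding Z_def by (rule cINF_greatest[OF that]) (rule assms(7))
  have Z_meas: "Z S \<in> borel_measurable borel" if "open S" "S \<noteq> {}" for S
    using random_lsc_INF_measurable[OF assms(8) assms(7) that] by (simp add: Z_def[abs_def])
  \<comment> \<open>The value at any one point of \<open>S\<close> dominates the nonnegative
    infimum. This makes \<open>Z S\<close> admissible in the convergence hypothesis.\<close>
  have Z_Lp: "(\<lambda>\<omega>. Z S (\<xi> \<omega>)) \<in> Lp M (p + \<epsilon>)" if S: "open S" "x \<in> S" for S x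
  proof (rule Lp_bound[OF pe0 _ assms(9)[of x]])
    have ne: "S \<noteq> {}" using S by auto
    show "(\<lambda>\<omega>. Z S (\<xi> \<omega>)) \<in> borel_measurable M"
      using measurable_compose[OF assms(4) Z_meas[OF S(1) ne]] .
    show "AE \<omega> in M. \<bar>Z S (\<xi> \<omega>)\<bar> \<le> \<bar>F (x, \<xi> \<omega>)\<bar>"
      using Z_nonneg[OF ne] Z_le[OF S(2)] assms(7) by (auto simp: abs_of_nonneg)
  qed
  \<comment> \<open>The neighbourhoods \<open>A k\<close> need not lie in \<open>B\<close>. Choosing
    basis sets inside them keeps all infima in one countable family.\<close>
  have shrink: "\<exists>S. (\<forall>k. S k \<in> B \<and> x \<in> S k) \<and>
      (\<forall>u. (\<lambda>k. Z (S k) u) \<longlonglongrightarrow> F (x, u))" for x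
  proof -
    obtain A where A: "\<And>k::nat. open (A k)" "\<And>k. x \<in> A k"
      "\<And>S. open S \<Longrightarrow> x \<in> S \<Longrightarrow> eventually (\<lambda>k. A k \<subseteq> S) sequentially"
      using countable_basis_at_decseq[of x] by metis
    have "\<forall>k. \<exists>S\<in>B. x \<in> S \<and> S \<subseteq> A k"
      using topological_basisE[OF B(2) A(1,2)] by metis
    then obtain S where S: "\<And>k. S k \<in> B" "\<And>k. x \<in> S k" "\<And>k. S k \<subseteq> A k" by metis
    have "eventually (\<lambda>k. S k \<subseteq> T) sequentially" if "open T" "x \<in> T" for T
      using A(3)[OF that] by eventually_elim (use S(3) in blast)
    then have "(\<lambda>k. Z (S k) u) \<longlonglongrightarrow> F (x, u)" for u
      unfolding Z_def by (intro random_lsc_INF_tendsto assms(7,8) S(2)) auto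
    then show ?thesis using S by blast
  qed
  \<comment> \<open>Measurability of each section is derived: it is a pointwise limit of the
    measurable infima.\<close>
  have F_meas: "(\<lambda>u. F (x, u)) \<in> borel_measurable borel" for x
  proof -
    obtain S where S: "\<And>k. S k \<in> B" "\<And>k. x \<in> S k" "\<And>u. (\<lambda>k. Z (S k) u) \<longlonglongrightarrow> F (x, u)"
      using shrink[of x] by blast
    show ?thesis
      by (rule borel_measurable_LIMSEQ_real[of _ "\<lambda>k. Z (S k)"])
        (use S topological_basis_open[OF B(2)] in \<open>blast intro: Z_meas\<close>)+
  qed
  define f where "f x = \<rho> (\<lambda>\<omega>. F (x, \<xi> \<omega>))" for x
  define g where "g \<theta> N x = risk_of_law M p \<rho> (distr (\<nu> N \<theta>) borel (\<lambda>u. F (x, u)))" for \<theta> N x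
  obtain C where C: "countable C" "\<And>x e. 0 < e \<Longrightarrow> \<exists>d\<in>C. dist d x < e \<and> f d < f x + e"
    using countable_graph_dense[of f] by blast
  have AE_C: "AE \<theta> in T. \<forall>d\<in>C. (\<lambda>N. g \<theta> N d) \<longlonglongrightarrow> f d"
    unfolding g_def f_def
    using assms(16)[OF F_meas assms(9)] by (simp add: AE_ball_countable[OF C(1)])
  \<comment> \<open>A basis may contain the empty set, which is excluded because the properties of
    \<open>Z S\<close> rely on a point of \<open>S\<close>.\<close>
  have AE_B: "AE \<theta> in T. \<forall>S\<in>B - {{}}. (\<lambda>N. risk_of_law M p \<rho> (distr (\<nu> N \<theta>) borel (Z S)))
      \<longlonglongrightarrow> \<rho> (\<lambda>\<omega>. Z S (\<xi> \<omega>))"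
  proof -
    have "countable (B - {{}})" using B(1) by simp
    moreover have "AE \<theta> in T. (\<lambda>N. risk_of_law M p \<rho> (distr (\<nu> N \<theta>) borel (Z S)))
      \<longlonglongrightarrow> \<rho> (\<lambda>\<omega>. Z S (\<xi> \<omega>))" if "S \<in> B - {{}}" for S
    proof -
      have "open S" "S \<noteq> {}" using that topological_basis_open[OF B(2)] by auto
      then show ?thesis using assms(16)[OF Z_meas] Z_Lp by blast
    qed
    ultimately show ?thesis by (simp add: AE_ball_countable)
  qed
  have "AE \<theta> in T. epiconverges (\<lambda>N x. ereal (g \<theta> N x)) (\<lambda>x. ereal (f x))"
    using AE_C AE_B AE_space
  proof eventually_elim
    case (elim \<theta>)
    note \<theta> = elim(3)
    have "ereal (f x) \<le> liminf (\<lambda>n. ereal (g \<theta> n (xs n)))" if xs: "xs \<longlonglongrightarrow> x" for x xs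
      unfolding le_Liminf_iff
    proof (intro allI impI)
      fix y assume y: "y < ereal (f x)"
      obtain S where S: "\<And>k. S k \<in> B" "\<And>k. x \<in> S k" "\<And>u. (\<lambda>k. Z (S k) u) \<longlonglongrightarrow> F (x, u)"
        using shrink[of x] by blast
      have opS: "open (S k)" and neS: "S k \<noteq> {}" for k
        using S(1,2) topological_basis_open[OF B(2)] by auto
      obtain c where c: "y < ereal c" "ereal c < ereal (f x)"
        using ereal_dense2[OF y] by blast
      have Fx: "(\<lambda>\<omega>. F (x, \<xi> \<omega>)) \<in> Lp M p" using assms(9) sub by blast
      \<comment> \<open>The infima converge pointwise to the integrand at \<open>x\<close> and are
        dominated by that same function, so it serves as both limit and bound.\<close>
      obtain k where k: "c < \<rho> (\<lambda>\<omega>. Z (S k) (\<xi> \<omega>))"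
      proof (rule convex_risk_measure_lower_limit
          [OF assms(5,10) _ Fx _ Fx, of "\<lambda>k \<omega>. Z (S k) (\<xi> \<omega>)" c])
        show "(\<lambda>\<omega>. Z (S k) (\<xi> \<omega>)) \<in> borel_measurable M" for k
          using Z_Lp[OF opS S(2)] by (rule Lp_measurable)
        show "\<bar>Z (S k) (\<xi> \<omega>)\<bar> \<le> \<bar>F (x, \<xi> \<omega>)\<bar>" for k \<omega>
          using Z_nonneg[OF neS] Z_le[OF S(2)] assms(7) by (auto simp: abs_of_nonneg)
      qed (use S(3) c(2) in \<open>auto simp: f_def\<close>)
      have "(\<lambda>N. risk_of_law M p \<rho> (distr (\<nu> N \<theta>) borel (Z (S k)))) \<longlonglongrightarrow> \<rho> (\<lambda>\<omega>. Z (S k) (\<xi> \<omega>))"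
        using elim(2) S(1) neS by blast
      then have "eventually (\<lambda>n. c < risk_of_law M p \<rho> (distr (\<nu> n \<theta>) borel (Z (S k)))) sequentially"
        using k by (rule order_tendstoD)
      moreover have "eventually (\<lambda>n. xs n \<in> S k) sequentially"
        using xs opS S(2) by (rule topological_tendstoD)
      ultimately show "eventually (\<lambda>n. y < ereal (g \<theta> n (xs n))) sequentially"
      proof eventually_elim
        case (elim n)
        have sets: "sets (\<nu> n \<theta>) = sets borel" using assms(14)[OF \<theta>] .
        \<comment> \<open>This comparison holds for every \<open>\<theta>\<close> in
          \<open>space T\<close>, so the arbitrary points \<open>xs n\<close> contribute no further
          null sets.\<close>
        have "risk_of_law M p \<rho> (distr (\<nu> n \<theta>) borel (Z (S k))) \<le> g \<theta> n (xs n)"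
          unfolding g_def
        proof (rule risk_of_law_mono[OF assms(3,10,11) assms(13)[OF \<theta>]])
          show "Z (S k) \<in> borel_measurable (\<nu> n \<theta>)"
            "(\<lambda>u. F (xs n, u)) \<in> borel_measurable (\<nu> n \<theta>)"
            using Z_meas[OF opS neS] F_meas by (auto simp: measurable_cong_sets[OF sets refl])
          show "finite_moment p (distr (\<nu> n \<theta>) borel (Z (S k)))"
            by (rule assms(15)[OF \<theta> Z_meas[OF opS neS] Z_Lp[OF opS S(2)]])
          show "finite_moment p (distr (\<nu> n \<theta>) borel (\<lambda>u. F (xs n, u)))"
            by (rule assms(15)[OF \<theta> F_meas assms(9)])
        qed (use Z_le elim in auto)
        then have "ereal c < ereal (g \<theta> n (xs n))" using elim by simp
        with c(1) show ?case by (rule less_trans)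
      qed
    qed
    moreover have "\<exists>xs. xs \<longlonglongrightarrow> x \<and> limsup (\<lambda>n. ereal (g \<theta> n (xs n))) \<le> ereal (f x)" for x
    proof -
      obtain xs where "xs \<longlonglongrightarrow> x" "limsup (\<lambda>n. ereal (g \<theta> n (xs n))) \<le> ereal (f x)"
        by (rule diagonal_recovery_sequence[OF C(2) bspec[OF elim(1)]])
      then show ?thesis by blast
    qed
    ultimately show ?case by (auto simp: epiconverges_def)
  qed
  then show ?thesis by (simp add: f_def g_def)
qed

end
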